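(* Let $\mathscr C$ be the class of $n$-broadcast algorithms defined in the context, and let $\mathcal{A}\in\mathscr{C}$ be a network-oblivious algorithm for $n$-broadcast specified on $M(v(n))$. For every $1<p\le v(n)$ and $0\le\sigma_1\le\sigma_2$, we have $$\mathrm{GAP}_{\mathcal{A}}(n,p,\sigma_1,\sigma_2)=\Omega\!\left(\frac{\log\max\{2,\sigma_2\}}{\log\max\{2,\sigma_1\}+\log\log\max\{2,\sigma_2\}}\right).$$
   Context: Problem: given a vector $V[0,\dots,n-1]$ of $n$ entries, the $n$-broadcast problem requires to copy the value $V[0]$ into all other $V[i]$'s. Class $\mathscr{C}$: static algorithms for $n$-broadcast such that any $\mathcal A\in\mathscr C$ for $q$ processing elements satisfies: (i) at least $\epsilon q$ processing elements hold entries of $V$, for some constant $0<\epsilon\le1$, and the distribution of the entries of $V$ among the processing elements cannot change during the execution of the algorithm; (ii) all foldings of $\mathcal A$ on $q'$ processing elements, $2\le q'<q$, also belong to $\mathscr C$. Gap: $H^\star(n,p,\sigma)$ denotes the best communication complexity achievable on $M(p,\sigma)$ by an algorithm for $n$-broadcast belonging to $\mathscr C$ (such an algorithm may depend on $p$ and $\sigma$), and $$\mathrm{GAP}_{\mathcal A}(n,p,\sigma_1,\sigma_2)=\max_{\sigma_1\le\sigma\le\sigma_2}\left\{\frac{H_{\mathcal A}(n,p,\sigma)}{H^\star(n,p,\sigma)}\right\}.$$ Conventions: $\log x$ means $\max\{1,\log_2 x\}$; numbers of processing elements are powers of two. Machine $M(v)$: $v$ processing elements (PEs) $P_0,\dots,P_{v-1}$,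 each a random access machine with unbounded local memory. An $M(v)$-algorithm runs as a sequence of supersteps, each with a label $i\in\{0,\dots,\log v-1\}$ (the label sequence is the same for all PEs). In an $i$-superstep each PE performs local computation and sends constant-size messages, only to PEs whose index agrees with its own in the $i$ most significant bits; the superstep ends with a barrier among such PEs, after which messages are available at their destinations. The algorithm is static if, for all inputs of the same size $n$, the number of supersteps, the sequence of labels, and the set of source-destination pairs of the messages of each superstep are the same. Folding: an $M(v)$-algorithm is executed on $M(p)$, $p<v$, by letting $P_j$ carry out the operations of the $v/p$ consecutively numbered PEs of $M(v)$ starting from the one with index $j(v/p)$. Supersteps with label $i<\log p$ keep their label; supersteps with label $i\ge\log p$ become local computation. For a static algorithm $\mathcal{A}$: $L^i_{\mathcal{A}}(n)$ is the set of $i$-supersteps, $S^i_{\mathcal{A}}(n)=|L^i_{\mathcal{A}}(n)|$; for $s\in L^i_{\mathcal{A}}(n)$, $i<\log p$, $h^s_{\mathcal{A}}(n,p)$ is the maximum number of messages sent by, or destined to, any processor in superstep $s$ when $\mathcal{A}$ is executed (folded) on $p$ processors (messages between PEs simulated by the same processor are not counted); $F^i_{\mathcal{A}}(n,p)=\sum_{s\in L^i_{\mathcal{A}}(n)}h^s_{\mathcal{A}}(n,p)$. Evaluation model $M(p,\sigma)$, $\sigma\ge0$: an $M(p)$ with communication complexity $H_{\mathcal{A}}(n,p,\sigma)=\sum_{i=0}^{\log p-1}\left(F^i_{\mathcal{A}}(n,p)+S^i_{\mathcal{A}}(n)\,\sigma\right)$. A network-oblivious algorithm is specified on $M(v(n))$,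 where $v(n)$ depends only on the input size (so the algorithm does not depend on $p$ or $\sigma$); it is executed on $M(p,\sigma)$, $p\le v(n)$, by folding, and $H_{\mathcal A}$ then refers to the folded algorithm.
   Formalization: The constant in Ω depends on a bound K for log σ2 / log p (that is, σ2 ≤ p^K); a constant uniform in p and σ2 is impossible, since for p = 2 a single message is optimal for every σ and the gap is 1. *)

theory Defs
  imports Complex_Main "HOL-Library.Extended_Real" "HOL-Library.Nat_Bijection"
begin

definition lg :: "real \<Rightarrow> real" where
  "lg x = max 1 (log 2 x)"

definition levels :: "nat \<Rightarrow> nat" where
  "levels p = nat \<lfloor>lg (real p)\<rfloor>"

definition pow2 :: "nat \<Rightarrow> bool" where
  "pow2 p \<longleftrightarrow> (\<exists>k. p = 2 ^ k)"


section \<open>Static algorithms on M(v)\<close>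

text \<open>
  A processing element is a random access machine with unbounded memory, \<open>'w\<close> being the type of
  machine words. Local computation is an arbitrary function of the local memory.
\<close>

type_synonym 'w memory = "nat \<Rightarrow> 'w"

text \<open>
  A step with \<open>label = Some i\<close> is an \<open>i\<close>-superstep; \<open>label = None\<close> is purely local computation, which
  is what a superstep may become under folding. Algorithms are static by construction: for a given
  input size the labels and the sources and destinations of the messages are fixed data, and only
  the contents of the messages depend on the memories.

  The messages of a step are the elements of the finite set \<open>msgs\<close> of identifiers. Identifiers,
  rather than pairs of processing elements, are used because after folding several messages may have
  the same source and the same destination. \<open>payload k\<close> is applied to the memory of \<open>src k\<close> at the
  beginning of the step; \<open>update j\<close> yields the memory of \<open>j\<close> after the barrier from its memory at the
  beginning of the step and the messages received, indexed by identifier.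
\<close>

record 'w step =
  label :: "nat option"
  msgs :: "nat set"
  src :: "nat \<Rightarrow> nat"
  dst :: "nat \<Rightarrow> nat"
  payload :: "nat \<Rightarrow> 'w memory \<Rightarrow> 'w list"
  update :: "nat \<Rightarrow> 'w memory \<Rightarrow> (nat \<Rightarrow> 'w list) \<Rightarrow> 'w memory"

text \<open>
  \<open>loc i\<close> is the pair (processing element, address) at which the entry \<open>V[i]\<close> is held; \<open>blank\<close> gives
  the initial, input-independent contents of all other memory cells.
\<close>

record 'w algo =
  npes :: nat
  loc :: "nat \<Rightarrow> nat \<times> nat"
  blank :: "nat \<Rightarrow> 'w memory"
  steps :: "'w step list"

text \<open>
  Indices have \<open>log v\<close> bits, so division by \<open>v div 2 ^ i\<close> extracts the \<open>i\<close> most significant ones.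
  Messages of constant size are messages of at most \<open>\<mu>\<close> words.
\<close>

definition valid_step :: "nat \<Rightarrow> nat \<Rightarrow> 'w step \<Rightarrow> bool" where
  "valid_step \<mu> v s \<longleftrightarrow>
     finite (msgs s) \<and>
     (\<forall>k\<in>msgs s. src s k < v \<and> dst s k < v \<and> (\<forall>m. length (payload s k m) \<le> \<mu>)) \<and>
     (case label s of
        None \<Rightarrow> msgs s = {}
      | Some i \<Rightarrow> i < levels v \<and>
          (\<forall>k\<in>msgs s. src s k div (v div 2 ^ i) = dst s k div (v div 2 ^ i)))"

definition run_step :: "'w step \<Rightarrow> (nat \<Rightarrow> 'w memory) \<Rightarrow> nat \<Rightarrow> 'w memory" where
  "run_step s M = (\<lambda>j. update s j (M j)
     (\<lambda>k. if k \<in> msgs s \<and> dst s k = j then payload s k (M (src s k)) else []))"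

definition run :: "'w algo \<Rightarrow> (nat \<Rightarrow> 'w memory) \<Rightarrow> nat \<Rightarrow> 'w memory" where
  "run A M = fold run_step (steps A) M"

definition load :: "'w algo \<Rightarrow> nat \<Rightarrow> (nat \<Rightarrow> 'w) \<Rightarrow> nat \<Rightarrow> 'w memory" where
  "load A n V = (\<lambda>j a. if \<exists>i<n. loc A i = (j, a) then V (THE i. i < n \<and> loc A i = (j, a))
                        else blank A j a)"

text \<open>
  Each entry is held in exactly one cell, and the result \<open>V[i] = V[0]\<close> is required in the cell that
  held \<open>V[i]\<close> initially: the distribution does not change.
\<close>

definition broadcast_algo :: "nat \<Rightarrow> nat \<Rightarrow> 'w algo \<Rightarrow> bool" where
  "broadcast_algo \<mu> n A \<longleftrightarrow>
     pow2 (npes A) \<and>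
     (\<forall>s\<in>set (steps A). valid_step \<mu> (npes A) s) \<and>
     inj_on (loc A) {..<n} \<and> (\<forall>i<n. fst (loc A i) < npes A) \<and>
     (\<forall>V. \<forall>i<n. run A (load A n V) (fst (loc A i)) (snd (loc A i)) = V 0)"


section \<open>Folding\<close>

text \<open>
  Processing element \<open>j\<close> of the folded algorithm simulates \<open>j * b + r\<close> for \<open>r < b\<close>. The memory of the
  \<open>r\<close>-th of these occupies the addresses \<open>prod_encode (r, a)\<close>.
\<close>

definition sub_mem :: "nat \<Rightarrow> 'w memory \<Rightarrow> 'w memory" where
  "sub_mem r m = (\<lambda>a. m (prod_encode (r, a)))"

definition join_mem :: "(nat \<Rightarrow> 'w memory) \<Rightarrow> 'w memory" where
  "join_mem f = (\<lambda>x. case prod_decode x of (r, a) \<Rightarrow> f r a)"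

definition fold_step :: "nat \<Rightarrow> nat \<Rightarrow> 'w step \<Rightarrow> 'w step" where
  "fold_step b p s =
     \<lparr>label = (case label s of None \<Rightarrow> None | Some i \<Rightarrow> if i < levels p then Some i else None),
      msgs = {k \<in> msgs s. src s k div b \<noteq> dst s k div b},
      src = (\<lambda>k. src s k div b),
      dst = (\<lambda>k. dst s k div b),
      payload = (\<lambda>k m. payload s k (sub_mem (src s k mod b) m)),
      update = (\<lambda>j m inbox. join_mem (\<lambda>r.
        if r < b then
          update s (j * b + r) (sub_mem r m)
            (\<lambda>k. if k \<in> msgs s \<and> dst s k = j * b + r
                 then (if src s k div b = j then payload s k (sub_mem (src s k mod b) m)
                       else inbox k)
                 else [])
        else sub_mem r m))\<rparr>"

definition fold_algo :: "nat \<Rightarrow> 'w algo \<Rightarrow> 'w algo" where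
  "fold_algo p A = (let b = npes A div p in
     \<lparr>npes = p,
      loc = (\<lambda>i. (fst (loc A i) div b, prod_encode (fst (loc A i) mod b, snd (loc A i)))),
      blank = (\<lambda>j. join_mem (\<lambda>r. blank A (j * b + r))),
      steps = map (fold_step b p) (steps A)\<rparr>)"


section \<open>Communication complexity\<close>

definition superstep_ids :: "'w algo \<Rightarrow> nat \<Rightarrow> nat set" where
  "superstep_ids A i = {t. t < length (steps A) \<and> label (steps A ! t) = Some i}"

definition S_count :: "'w algo \<Rightarrow> nat \<Rightarrow> nat" where
  "S_count A i = card (superstep_ids A i)"

definition degree :: "'w algo \<Rightarrow> nat \<Rightarrow> nat \<Rightarrow> nat" where
  "degree A p t = (let s = steps A ! t; b = npes A div p in
     Max ((\<lambda>j. max (card {k \<in> msgs s. src s k div b = j \<and> dst s k div b \<noteq> j})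
                   (card {k \<in> msgs s. dst s k div b = j \<and> src s k div b \<noteq> j})) ` {..<p}))"

definition F_count :: "'w algo \<Rightarrow> nat \<Rightarrow> nat \<Rightarrow> nat" where
  "F_count A i p = (\<Sum>t\<in>superstep_ids A i. degree A p t)"

definition comm :: "'w algo \<Rightarrow> nat \<Rightarrow> real \<Rightarrow> real" where
  "comm A p \<sigma> = (\<Sum>i<levels p. real (F_count A i p) + real (S_count A i) * \<sigma>)"


section \<open>The class of broadcast algorithms and the gap\<close>

text \<open>
  The closure under folding is well founded, since folding decreases the number of processing
  elements; hence the least and the greatest class satisfying the equation coincide.
\<close>

inductive_set bcast_class :: "real \<Rightarrow> nat \<Rightarrow> nat \<Rightarrow> 'w algo set"
  for \<epsilon> :: real and \<mu> :: nat and n :: nat where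
  "\<lbrakk>broadcast_algo \<mu> n A;
    \<epsilon> * real (npes A) \<le> real (card ((\<lambda>i. fst (loc A i)) ` {..<n}));
    \<forall>q. pow2 q \<and> 2 \<le> q \<and> q < npes A \<longrightarrow> fold_algo q A \<in> bcast_class \<epsilon> \<mu> n\<rbrakk>
   \<Longrightarrow> A \<in> bcast_class \<epsilon> \<mu> n"

definition best_comm :: "'w algo set \<Rightarrow> nat \<Rightarrow> real \<Rightarrow> ereal" where
  "best_comm C p \<sigma> = (INF B\<in>{B \<in> C. npes B = p}. ereal (comm B p \<sigma>))"

text \<open>
  The optimum may be \<open>0\<close>, but only if \<open>\<epsilon> * p \<le> 1\<close>, as one processing element may then hold all
  entries. The ratio of an algorithm attaining the optimum is \<open>1\<close> in this case as well; otherwise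
  division of a positive number by \<open>0\<close> gives \<open>\<infinity>\<close> in type \<open>ereal\<close>.
\<close>

definition comm_ratio :: "'w algo set \<Rightarrow> 'w algo \<Rightarrow> nat \<Rightarrow> real \<Rightarrow> ereal" where
  "comm_ratio C A p \<sigma> =
     (if comm A p \<sigma> = 0 \<and> best_comm C p \<sigma> = 0 then 1
      else ereal (comm A p \<sigma>) / best_comm C p \<sigma>)"

definition gap :: "'w algo set \<Rightarrow> 'w algo \<Rightarrow> nat \<Rightarrow> real \<Rightarrow> real \<Rightarrow> ereal" where
  "gap C A p \<sigma>1 \<sigma>2 = (SUP \<sigma>\<in>{\<sigma>1..\<sigma>2}. comm_ratio C A p \<sigma>)"

definition network_oblivious_bcast ::
    "real \<Rightarrow> nat \<Rightarrow> (nat \<Rightarrow> nat) \<Rightarrow> (nat \<Rightarrow> 'w algo) \<Rightarrow> bool" where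
  "network_oblivious_bcast \<epsilon> \<mu> v A \<longleftrightarrow>
     (\<forall>n\<ge>1. npes (A n) = v n \<and> A n \<in> bcast_class \<epsilon> \<mu> n)"

text \<open>
  A lower bound \<open>\<Omega>(log \<sigma>2 / (log \<sigma>1 + log log \<sigma>2))\<close> on the gap cannot hold with a constant that is
  uniform in \<open>p\<close> and \<open>\<sigma>2\<close>: for \<open>p = 2\<close>, one superstep with one message has cost \<open>1 + \<sigma>\<close>, which is
  optimal for every \<open>\<sigma>\<close> when \<open>\<epsilon> = 1\<close> and \<open>n \<ge> 2\<close>, so that the gap is \<open>1\<close> for arbitrarily large \<open>\<sigma>2\<close>.
  The implied constant therefore has to depend on a bound \<open>K\<close> for \<open>log \<sigma>2 / log p\<close>.
\<close>

end

theory Submission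
  imports Defs
begin

text \<open>
  Lower bound: the processing elements whose memory depends on \<open>V[0]\<close> multiply by at most \<open>1 + h\<close> in a
  superstep of degree \<open>h\<close>, and \<open>1 + h \<le> \<theta> * exp (h / \<theta>)\<close> for \<open>\<theta> \<ge> 1\<close>. As all elements holding entries
  must be reached, an algorithm with \<open>T\<close> supersteps of total degree \<open>H\<close>, whose cost is \<open>H + T * \<sigma>\<close>,
  satisfies \<open>\<epsilon> * p \<le> exp (T * ln \<theta> + H / \<theta>)\<close>. Upper bound: a tree of arity about
  \<open>s = max 2 \<sigma>\<close> broadcasts at cost \<open>O(s * log p / log s)\<close>, and all its foldings belong to the class.
  Since \<open>H\<close> and \<open>T\<close> do not depend on \<open>\<sigma>\<close>, a suitable choice of \<open>\<theta>\<close> shows that an algorithm cannot be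
  close to the tree both at \<open>\<sigma>1\<close> and at \<open>\<sigma>2\<close>.
\<close>

section \<open>The cost as a sum over the steps\<close>

definition step_degree :: "nat \<Rightarrow> nat \<Rightarrow> 'w step \<Rightarrow> nat" where
  "step_degree b p s =
     Max ((\<lambda>j. max (card {k \<in> msgs s. src s k div b = j \<and> dst s k div b \<noteq> j})
                   (card {k \<in> msgs s. dst s k div b = j \<and> src s k div b \<noteq> j})) ` {..<p})"

definition counted :: "nat \<Rightarrow> 'w step \<Rightarrow> bool" where
  "counted p s \<longleftrightarrow> (\<exists>i<levels p. label s = Some i)"

lemma degree_eq: "degree A p t = step_degree (npes A div p) p (steps A ! t)"
  by (simp add: degree_def step_degree_def Let_def)

text \<open>Exchanging the sums over labels and positions leaves one term per counted step, as a
  step has at most one label. In this form the cost can be compared step by step across a folding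
  and treated by induction on the list.\<close>

lemma comm_eq_sum_list:
  "comm A p \<sigma> = (\<Sum>s\<leftarrow>steps A. if counted p s then real (step_degree (npes A div p) p s) + \<sigma> else 0)"
proof -
  define f where "f t = real (degree A p t) + \<sigma>" for t
  have "comm A p \<sigma> = (\<Sum>i<levels p. \<Sum>t\<in>superstep_ids A i. f t)"
    by (simp add: comm_def F_count_def S_count_def f_def sum.distrib)
  also have "\<dots> = (\<Sum>i<levels p. \<Sum>t<length (steps A). if label (steps A ! t) = Some i then f t else 0)"
    using sum.inter_filter[of "{..<length (steps A)}" f "\<lambda>t. label (steps A ! t) = Some i" for i]
    by (simp add: superstep_ids_def)
  also have "\<dots> = (\<Sum>t<length (steps A). \<Sum>i<levels p. if label (steps A ! t) = Some i then f t else 0)"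
    by (rule sum.swap)
  also have "\<dots> = (\<Sum>t<length (steps A). if counted p (steps A ! t) then f t else 0)"
  proof (rule sum.cong[OF refl])
    fix t
    show "(\<Sum>i<levels p. if label (steps A ! t) = Some i then f t else 0) =
          (if counted p (steps A ! t) then f t else 0)"
      by (cases "label (steps A ! t)") (auto simp: counted_def)
  qed
  also have "\<dots> = (\<Sum>s\<leftarrow>steps A. if counted p s then real (step_degree (npes A div p) p s) + \<sigma> else 0)"
    by (simp add: sum_list_sum_nth f_def degree_eq atLeast0LessThan cong: if_cong)
  finally show ?thesis .
qed

lemma comm_nonneg: "0 \<le> \<sigma> \<Longrightarrow> 0 \<le> comm A p \<sigma>"
  unfolding comm_eq_sum_list by (rule sum_list_nonneg) auto

lemma levels_pow2: "1 \<le> k \<Longrightarrow> levels (2 ^ k) = k"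
  by (simp add: levels_def lg_def log_nat_power max_def)


section \<open>Folding\<close>

lemma sub_mem_join_mem [simp]: "sub_mem r (join_mem f) = f r"
  by (simp add: sub_mem_def join_mem_def)

text \<open>The messages dropped by folding stay inside a block of size \<open>b\<close>, and the
  degree with block size \<open>b\<close> ignores these anyway.\<close>

lemma step_degree_fold_step: "step_degree 1 p (fold_step b p s) = step_degree b p s"
proof -
  have "{k \<in> msgs (fold_step b p s). src (fold_step b p s) k div 1 = j \<and> dst (fold_step b p s) k div 1 \<noteq> j}
      = {k \<in> msgs s. src s k div b = j \<and> dst s k div b \<noteq> j}"
    "{k \<in> msgs (fold_step b p s). dst (fold_step b p s) k div 1 = j \<and> src (fold_step b p s) k div 1 \<noteq> j}
      = {k \<in> msgs s. dst s k div b = j \<and> src s k div b \<noteq> j}" for j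
    by (auto simp: fold_step_def)
  then show ?thesis by (simp only: step_degree_def)
qed

lemma counted_fold_step: "counted p (fold_step b p s) = counted p s"
  by (auto simp: counted_def fold_step_def split: option.splits if_splits)

lemma comm_fold_algo: "0 < p \<Longrightarrow> comm (fold_algo p A) p \<sigma> = comm A p \<sigma>"
  by (simp add: comm_eq_sum_list fold_algo_def Let_def o_def counted_fold_step
        step_degree_fold_step[simplified] cong: if_cong)

text \<open>The simulation invariant: slice \<open>r\<close> of the memory of \<open>j\<close> is
  the memory of \<open>j * b + r\<close>. The bound on the sources puts every sender inside the
  simulated range, so the invariant also yields the payloads, whether they are computed locally or
  received.\<close>

lemma run_step_fold_step:
  assumes "\<And>j r. j < p \<Longrightarrow> r < b \<Longrightarrow> sub_mem r (M' j) = M (j * b + r)"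
    and "\<And>k. k \<in> msgs s \<Longrightarrow> src s k < p * b"
    and "j < p" and "r < b"
  shows "sub_mem r (run_step (fold_step b p s) M' j) = run_step s M (j * b + r)"
proof -
  have src: "sub_mem (src s k mod b) (M' (src s k div b)) = M (src s k)" if "k \<in> msgs s" for k
  proof -
    have "src s k div b < p" "src s k mod b < b"
      using assms(2)[OF that] \<open>r < b\<close> by (simp_all add: less_mult_imp_div_less)
    from assms(1)[OF this] show ?thesis by simp
  qed
  have div: "(j * b + r) div b = j"
    using \<open>r < b\<close> by simp
  show ?thesis
    unfolding run_step_def
    using assms(1)[OF \<open>j < p\<close> \<open>r < b\<close>] \<open>r < b\<close>
    by (auto simp: fold_step_def src div intro!: ext arg_cong[where f = "update s (j * b + r) (M (j * b + r))"])
qed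

lemma run_fold_steps:
  assumes "\<And>j r. j < p \<Longrightarrow> r < b \<Longrightarrow> sub_mem r (M' j) = M (j * b + r)"
    and "\<forall>s\<in>set ss. \<forall>k\<in>msgs s. src s k < p * b"
    and "j < p" and "r < b"
  shows "sub_mem r (fold run_step (map (fold_step b p) ss) M' j) = fold run_step ss M (j * b + r)"
  using assms
proof (induction ss arbitrary: M M')
  case (Cons s ss)
  have *: "sub_mem r (run_step (fold_step b p s) M' j) = run_step s M (j * b + r)"
    if "j < p" "r < b" for j r
    using run_step_fold_step[of p b M' M s, OF Cons.prems(1)] that Cons.prems(2) by auto
  show ?case
    using Cons.IH[of "run_step (fold_step b p s) M'" "run_step s M", OF *] Cons.prems by simp
qed simp

lemma load_fold_algo:
  assumes "r < b" and "b = npes A div p"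
  shows "sub_mem r (load (fold_algo p A) n V j) = load A n V (j * b + r)"
proof -
  have "loc (fold_algo p A) i = (j, prod_encode (r, a)) \<longleftrightarrow> loc A i = (j * b + r, a)" for i a
  proof (cases "loc A i")
    case (Pair x y)
    have "x div b = j \<and> x mod b = r \<longleftrightarrow> x = j * b + r"
      using \<open>r < b\<close> by auto
    with Pair assms(2) show ?thesis
      by (auto simp: fold_algo_def Let_def)
  qed
  then show ?thesis
    by (auto simp: load_def sub_mem_def fun_eq_iff assms(2)[symmetric])
       (simp add: fold_algo_def Let_def join_mem_def assms(2))
qed

lemma pow2_div: "k \<le> m \<Longrightarrow> (2::nat) ^ m div 2 ^ k = 2 ^ (m - k)"
  by (simp add: power_diff)

text \<open>A cluster of label \<open>i\<close> has \<open>2 ^ (m - i)\<close> elements. For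
  \<open>i \<ge> k\<close> it lies inside one block, so no message survives and the step may become
  local; for \<open>i < k\<close> it consists of whole blocks, which form the cluster of label
  \<open>i\<close> after folding.\<close>

lemma valid_step_fold_step:
  assumes "valid_step \<mu> (2 ^ m) s" and "1 \<le> k" and "k \<le> m"
  shows "valid_step \<mu> (2 ^ k) (fold_step (2 ^ (m - k)) (2 ^ k) s)"
proof -
  let ?b = "2 ^ (m - k) :: nat"
  have pb: "(2::nat) ^ m = 2 ^ k * ?b"
    using \<open>k \<le> m\<close> by (simp flip: power_add)
  have lt: "x div ?b < 2 ^ k" if "x < 2 ^ m" for x :: nat
    using that unfolding pb by (simp add: less_mult_imp_div_less)
  have local: "src s l div ?b = dst s l div ?b"
    if "label s = Some i" "k \<le> i" "l \<in> msgs s" for i l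
  proof -
    have "i < m" "src s l div (2 ^ m div 2 ^ i) = dst s l div (2 ^ m div 2 ^ i)"
      using assms that by (auto simp: valid_step_def levels_pow2)
    then have "src s l div 2 ^ (m - i) div 2 ^ (i - k) = dst s l div 2 ^ (m - i) div 2 ^ (i - k)"
      by (simp add: pow2_div)
    then show ?thesis
      using \<open>i < m\<close> \<open>k \<le> i\<close> by (simp add: flip: div_mult2_eq power_add)
  qed
  have cluster: "src s l div ?b div (2 ^ k div 2 ^ i) = dst s l div ?b div (2 ^ k div 2 ^ i)"
    if "label s = Some i" "i < k" "l \<in> msgs s" for i l
  proof -
    have "src s l div (2 ^ m div 2 ^ i) = dst s l div (2 ^ m div 2 ^ i)"
      using assms that by (auto simp: valid_step_def)
    then show ?thesis
      using \<open>i < k\<close> \<open>k \<le> m\<close> by (simp add: pow2_div flip: div_mult2_eq power_add)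
  qed
  show ?thesis
    using assms lt local cluster unfolding valid_step_def
    by (auto simp: fold_step_def levels_pow2 split: option.splits if_splits)
qed

lemma broadcast_algo_fold_algo:
  assumes A: "broadcast_algo \<mu> n A" and np: "npes A = 2 ^ m" and "1 \<le> k" and "k \<le> m"
  shows "broadcast_algo \<mu> n (fold_algo (2 ^ k) A)"
proof -
  define b :: nat where "b = 2 ^ (m - k)"
  define B where "B = fold_algo (2 ^ k) A"
  have b: "npes A div 2 ^ k = b" "0 < b" and pb: "(2::nat) ^ m = 2 ^ k * b"
    using \<open>k \<le> m\<close> by (simp_all add: b_def np pow2_div flip: power_add)
  have loc_B: "loc B i = (fst (loc A i) div b, prod_encode (fst (loc A i) mod b, snd (loc A i)))" for i
    by (simp add: B_def fold_algo_def Let_def b)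
  have steps_B: "steps B = map (fold_step b (2 ^ k)) (steps A)"
    by (simp add: B_def fold_algo_def Let_def b)
  have npes_B: "npes B = 2 ^ k"
    by (simp add: B_def fold_algo_def Let_def)
  have loc_lt: "fst (loc B i) < 2 ^ k" if "i < n" for i
    using A that by (auto simp: broadcast_algo_def loc_B np pb less_mult_imp_div_less)
  have "inj_on (loc B) {..<n}"
  proof (rule inj_onI)
    fix x y assume xy: "x \<in> {..<n}" "y \<in> {..<n}" "loc B x = loc B y"
    then have "fst (loc A x) div b = fst (loc A y) div b" "fst (loc A x) mod b = fst (loc A y) mod b"
      "snd (loc A x) = snd (loc A y)"
      by (auto simp: loc_B)
    then have "loc A x = loc A y"
      by (metis div_mod_decomp prod.expand)
    with A xy show "x = y" by (auto simp: broadcast_algo_def dest: inj_onD)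
  qed
  moreover have "run B (load B n V) (fst (loc B i)) (snd (loc B i)) = V 0" if "i < n" for V i
  proof -
    have valid: "\<forall>s\<in>set (steps A). \<forall>l\<in>msgs s. src s l < 2 ^ k * b"
      using A by (auto simp: broadcast_algo_def valid_step_def np pb)
    have "sub_mem (fst (loc A i) mod b) (run B (load B n V) (fst (loc B i))) =
        run A (load A n V) (fst (loc B i) * b + fst (loc A i) mod b)"
      unfolding run_def steps_B
      by (rule run_fold_steps)
         (use valid loc_lt[OF that] b in \<open>auto simp: B_def load_fold_algo\<close>)
    also have "fst (loc B i) * b + fst (loc A i) mod b = fst (loc A i)"
      by (simp add: loc_B)
    finally have "run B (load B n V) (fst (loc B i)) (snd (loc B i)) =
        run A (load A n V) (fst (loc A i)) (snd (loc A i))"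
      by (simp add: sub_mem_def fun_eq_iff loc_B)
    with A that show ?thesis by (simp add: broadcast_algo_def)
  qed
  moreover have "\<forall>s\<in>set (steps B). valid_step \<mu> (npes B) s"
    using A \<open>1 \<le> k\<close> \<open>k \<le> m\<close>
    by (auto simp: broadcast_algo_def steps_B npes_B np b_def intro!: valid_step_fold_step)
  ultimately show ?thesis
    unfolding B_def[symmetric] using loc_lt by (auto simp: broadcast_algo_def npes_B pow2_def)
qed

section \<open>Membership in the class and its foldings\<close>

text \<open>The quotient is \<open>m / b\<close> rounded up. It counts the blocks meeting an initial
  segment, and later the rounds of the tree.\<close>

lemma less_ceiling_div_iff:
  fixes x m b :: nat
  assumes "0 < b"
  shows "x < (m + b - 1) div b \<longleftrightarrow> x * b < m"
proof -
  have "x < (m + b - 1) div b \<longleftrightarrow> Suc x * b \<le> m + b - 1"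
    using assms by (metis Suc_le_eq less_eq_div_iff_mult_less_eq)
  also have "\<dots> \<longleftrightarrow> x * b < m" using assms by auto
  finally show ?thesis .
qed

text \<open>If the entries are spread over an initial segment of the processing elements, then so they are
  in every folding, with at least the same density.\<close>

lemma bcast_classI:
  assumes "broadcast_algo \<mu> n A" and "(\<lambda>i. fst (loc A i)) ` {..<n} = {..<m}"
    and "\<epsilon> * real (npes A) \<le> real m"
  shows "A \<in> bcast_class \<epsilon> \<mu> n"
  using assms
proof (induction "npes A" arbitrary: A m rule: less_induct)
  case less
  obtain e where e: "npes A = 2 ^ e"
    using less.prems by (auto simp: broadcast_algo_def pow2_def)
  have "fold_algo q A \<in> bcast_class \<epsilon> \<mu> n" if q: "pow2 q" "2 \<le> q" "q < npes A" for q
  proof -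
    obtain k where k: "q = 2 ^ k" using q by (auto simp: pow2_def)
    have "1 \<le> k" using q k by (cases k) auto
    have "k \<le> e" using q k e by simp
    define b :: nat where "b = 2 ^ (e - k)"
    have b: "npes A div q = b" "0 < b" "npes A = q * b"
      using \<open>k \<le> e\<close> by (simp_all add: b_def e k pow2_div flip: power_add)
    define m' where "m' = (m + b - 1) div b"
    have m'_iff: "x < m' \<longleftrightarrow> x * b < m" for x
      unfolding m'_def by (rule less_ceiling_div_iff) (rule b(2))
    have "(\<lambda>i. fst (loc (fold_algo q A) i)) ` {..<n} = (\<lambda>x. x div b) ` {..<m}"
      by (simp add: fold_algo_def Let_def b(1) image_image flip: less.prems(2))
    also have "\<dots> = {..<m'}"
    proof (intro set_eqI iffI)
      fix x assume "x \<in> (\<lambda>x. x div b) ` {..<m}"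
      then obtain y where "y < m" "x = y div b" by auto
      then show "x \<in> {..<m'}"
        using m'_iff[of x] div_times_less_eq_dividend[of y b] by auto
    next
      fix x assume "x \<in> {..<m'}"
      then show "x \<in> (\<lambda>x. x div b) ` {..<m}"
        using m'_iff[of x] b(2) by (auto intro!: image_eqI[of _ _ "x * b"])
    qed
    finally have img: "(\<lambda>i. fst (loc (fold_algo q A) i)) ` {..<n} = {..<m'}" .
    \<comment> \<open>Rounding up makes \<open>m'\<close> blocks cover all \<open>m\<close>
      elements, so the density does not drop.\<close>
    have "m \<le> m' * b" using m'_iff[of m'] by simp
    then have "real m \<le> real m' * real b" by (metis of_nat_le_iff of_nat_mult)
    moreover have "(\<epsilon> * real q) * real b = \<epsilon> * real (npes A)" unfolding b(3) by simp
    ultimately have "(\<epsilon> * real q) * real b \<le> real m' * real b" using less.prems(3) by linarith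
    with b(2) have "\<epsilon> * real q \<le> real m'" by simp
    then show ?thesis
      using less.hyps[of "fold_algo q A" m'] broadcast_algo_fold_algo[OF less.prems(1) e \<open>1 \<le> k\<close> \<open>k \<le> e\<close>]
        img q by (auto simp: k fold_algo_def Let_def)
  qed
  then show ?case
    using less.prems by (intro bcast_class.intros) auto
qed

text \<open>Reduces cost questions on \<open>p\<close> elements to a member of the class with
  exactly \<open>p\<close>. The closure condition covers only proper foldings, so for
  \<open>p = npes A\<close> the algorithm itself is taken.\<close>

lemma bcast_class_fold:
  fixes A :: "'w algo"
  assumes "A \<in> bcast_class \<epsilon> \<mu> n" and "pow2 p" and "1 < p" and "p \<le> npes A"
  obtains B :: "'w algo" where "B \<in> bcast_class \<epsilon> \<mu> n" and "npes B = p" and "\<And>\<sigma>. comm B p \<sigma> = comm A p \<sigma>"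
proof (cases "p = npes A")
  case True
  then show ?thesis using that[of A] assms by simp
next
  case False
  then have "fold_algo p A \<in> bcast_class \<epsilon> \<mu> n"
    using assms by (auto elim: bcast_class.cases)
  then show ?thesis
    using that[of "fold_algo p A"] comm_fold_algo[of p A] assms(3)
    by (simp add: fold_algo_def[THEN arg_cong[where f = npes]] Let_def)
qed


section \<open>Spreading of information\<close>

text \<open>An upper bound for the set of elements whose memory can depend on the initial memories
  of \<open>R\<close>: nothing is forgotten, and every message from \<open>R\<close> counts as
  informative.\<close>

definition spread :: "'w step \<Rightarrow> nat set \<Rightarrow> nat set" where
  "spread s R = R \<union> dst s ` {k \<in> msgs s. src s k \<in> R}"

lemma run_step_agree:
  assumes "\<And>j. j \<notin> R \<Longrightarrow> M j = M' j" and "j \<notin> spread s R"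
  shows "run_step s M j = run_step s M' j"
proof -
  have "src s k \<notin> R" if "k \<in> msgs s" "dst s k = j" for k
    using that assms(2) by (auto simp: spread_def)
  then have "(\<lambda>k. if k \<in> msgs s \<and> dst s k = j then payload s k (M (src s k)) else []) =
        (\<lambda>k. if k \<in> msgs s \<and> dst s k = j then payload s k (M' (src s k)) else [])"
    by (intro ext if_cong refl) (simp add: assms(1))
  moreover have "M j = M' j" using assms by (auto simp: spread_def)
  ultimately show ?thesis by (simp add: run_step_def)
qed

lemma run_agree:
  assumes "\<And>j. j \<notin> R \<Longrightarrow> M j = M' j" and "j \<notin> fold spread ss R"
  shows "fold run_step ss M j = fold run_step ss M' j"
  using assms
proof (induction ss arbitrary: M M' R)
  case (Cons s ss)
  show ?case
    using Cons.IH[of "spread s R" "run_step s M" "run_step s M'"] run_step_agree[of R M M' _ s] Cons.prems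
    by simp
qed simp

text \<open>Each element of \<open>R\<close> adds at most as many new elements as it sends messages
  to others.\<close>

lemma card_spread_le:
  assumes "valid_step \<mu> p s" and "finite R"
  shows "finite (spread s R)" and "card (spread s R) \<le> card R * (1 + step_degree 1 p s)"
proof -
  let ?out = "\<lambda>j. {k \<in> msgs s. src s k = j \<and> dst s k \<noteq> j}"
  have fin: "finite (msgs s)" using assms by (simp add: valid_step_def)
  then show "finite (spread s R)" using assms by (simp add: spread_def)
  have out: "card (?out j) \<le> step_degree 1 p s" for j
  proof (cases "j < p")
    case True
    have "card (?out j) \<le> max (card (?out j)) (card {k \<in> msgs s. dst s k = j \<and> src s k \<noteq> j})"
      by simp
    also have "\<dots> \<le> step_degree 1 p s"
      unfolding step_degree_def div_by_1 using True by (intro Max_ge) auto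
    finally show ?thesis .
  next
    \<comment> \<open>\<open>R\<close> is an arbitrary finite set; elements outside the machine send
      nothing.\<close>
    case False
    with assms(1) have "?out j = {}" by (auto simp: valid_step_def)
    then have "card (?out j) = 0" by (simp only: card.empty)
    then show ?thesis by linarith
  qed
  have "y \<in> R \<union> (\<Union>j\<in>R. dst s ` ?out j)" if "y \<in> spread s R" for y
  proof (cases "y \<in> R")
    case False
    with that obtain k where "k \<in> msgs s" "src s k \<in> R" "y = dst s k"
      by (auto simp: spread_def)
    with False have "y \<in> dst s ` ?out (src s k)" by auto
    with \<open>src s k \<in> R\<close> show ?thesis by blast
  qed simp
  then have "spread s R \<subseteq> R \<union> (\<Union>j\<in>R. dst s ` ?out j)" ..
  then have "card (spread s R) \<le> card (R \<union> (\<Union>j\<in>R. dst s ` ?out j))"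
    using fin assms(2) by (intro card_mono) auto
  also have "\<dots> \<le> card R + card (\<Union>j\<in>R. dst s ` ?out j)"
    by (rule card_Un_le)
  also have "card (\<Union>j\<in>R. dst s ` ?out j) \<le> (\<Sum>j\<in>R. card (dst s ` ?out j))"
    by (rule card_UN_le[OF assms(2)])
  also have "\<dots> \<le> (\<Sum>j\<in>R. step_degree 1 p s)"
    using fin by (intro sum_mono order_trans[OF card_image_le out]) auto
  finally show "card (spread s R) \<le> card R * (1 + step_degree 1 p s)" by simp
qed

text \<open>Bounding the growth factors by exponentials turns their product into a sum;
  \<open>g\<close> is left open so that it can depend on a threshold.\<close>

lemma card_fold_spread_le:
  assumes "\<forall>s\<in>set ss. valid_step \<mu> p s \<and> real (1 + step_degree 1 p s) \<le> exp (g s)" and "finite R"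
  shows "finite (fold spread ss R)"
    and "real (card (fold spread ss R)) \<le> real (card R) * exp (\<Sum>s\<leftarrow>ss. g s)"
proof -
  have "finite (fold spread ss R) \<and> real (card (fold spread ss R)) \<le> real (card R) * exp (\<Sum>s\<leftarrow>ss. g s)"
    using assms
  proof (induction ss arbitrary: R)
    case (Cons s ss)
    have s: "finite (spread s R)" "card (spread s R) \<le> card R * (1 + step_degree 1 p s)"
      using card_spread_le Cons.prems by auto
    have "real (card (spread s R)) \<le> real (card R) * real (1 + step_degree 1 p s)"
      using s(2) by (metis of_nat_le_iff of_nat_mult)
    also have "\<dots> \<le> real (card R) * exp (g s)"
      using Cons.prems by (intro mult_left_mono) auto
    finally have le: "real (card (spread s R)) * exp (\<Sum>s\<leftarrow>ss. g s)
        \<le> real (card R) * exp (g s) * exp (\<Sum>s\<leftarrow>ss. g s)"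
      by (rule mult_right_mono) simp
    have "finite (fold spread ss (spread s R)) \<and>
        real (card (fold spread ss (spread s R))) \<le> real (card (spread s R)) * exp (\<Sum>s\<leftarrow>ss. g s)"
      by (rule Cons.IH[OF _ s(1)]) (use Cons.prems in auto)
    with order_trans[OF _ le] show ?case
      by (simp only: fold_simps list.map sum_list.Cons exp_add mult.assoc)
  qed simp
  then show "finite (fold spread ss R)"
    and "real (card (fold spread ss R)) \<le> real (card R) * exp (\<Sum>s\<leftarrow>ss. g s)" by auto
qed

text \<open>Two inputs that differ only in \<open>V[0]\<close> would leave the same memory in an
  element outside the spread, although it must end up holding \<open>V[0]\<close>. Two distinct
  words are needed to form such inputs.\<close>

lemma broadcast_spread:
  fixes B :: "'w algo"
  assumes "broadcast_algo \<mu> n B" and "\<exists>x y :: 'w. x \<noteq> y" and "1 \<le> n"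
  shows "(\<lambda>i. fst (loc B i)) ` {..<n} \<subseteq> fold spread (steps B) {fst (loc B 0)}"
proof
  fix j assume "j \<in> (\<lambda>i. fst (loc B i)) ` {..<n}"
  then obtain i where i: "i < n" "j = fst (loc B i)" by auto
  obtain x y :: 'w where "x \<noteq> y" using assms by auto
  define V where "V = (\<lambda>_::nat. y)"
  have inj: "inj_on (loc B) {..<n}" using assms by (simp add: broadcast_algo_def)
  have load: "load B n (V(0 := x)) j' = load B n V j'" if "j' \<noteq> fst (loc B 0)" for j'
  proof
    fix a
    show "load B n (V(0 := x)) j' a = load B n V j' a"
    proof (cases "\<exists>i<n. loc B i = (j', a)")
      case True
      then obtain l where l: "l < n" "loc B l = (j', a)" by auto
      then have "(THE i. i < n \<and> loc B i = (j', a)) = l"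
        using inj by (intro the_equality) (auto simp: inj_on_def)
      \<comment> \<open>An entry held by another element is not \<open>V[0]\<close>, so changing
        \<open>V[0]\<close> does not affect it.\<close>
      moreover have "l \<noteq> 0" using l that by (metis fst_conv)
      ultimately show ?thesis using True by (simp add: load_def)
    next
      case False
      show ?thesis unfolding load_def if_not_P[OF False] by (rule refl)
    qed
  qed
  show "j \<in> fold spread (steps B) {fst (loc B 0)}"
  proof (rule ccontr)
    assume "j \<notin> fold spread (steps B) {fst (loc B 0)}"
    then have "run B (load B n (V(0 := x))) j = run B (load B n V) j"
      unfolding run_def by (intro run_agree[of "{fst (loc B 0)}"]) (auto simp: load)
    moreover have "run B (load B n W) j (snd (loc B i)) = W 0" for W
      using assms i by (auto simp: broadcast_algo_def)
    ultimately have "(V(0 := x)) 0 = V 0" by metis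
    with \<open>x \<noteq> y\<close> show False by (simp add: V_def)
  qed
qed

section \<open>Trade-off between the number of supersteps and their degrees\<close>

text \<open>\<open>T\<close> is the number of supersteps and \<open>H\<close> their total degree.
  Both are fixed before \<open>\<sigma>\<close> and \<open>\<theta>\<close>, so one pair serves
  every \<open>\<sigma>\<close> and the threshold can be chosen freely afterwards.\<close>

lemma bcast_class_lower:
  fixes B :: "'w algo"
  assumes "B \<in> bcast_class \<epsilon> \<mu> n" and "npes B = p" and "0 < p" and "1 \<le> n"
    and "\<exists>x y :: 'w. x \<noteq> y"
  obtains H T :: real where "0 \<le> H" and "0 \<le> T" and "\<And>\<sigma>. comm B p \<sigma> = H + T * \<sigma>"
    and "\<And>\<theta>. 1 \<le> \<theta> \<Longrightarrow> \<epsilon> * real p \<le> exp (T * ln \<theta> + H / \<theta>)"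
proof -
  have B: "broadcast_algo \<mu> n B" "\<epsilon> * real p \<le> real (card ((\<lambda>i. fst (loc B i)) ` {..<n}))"
    using assms(1,2) by (auto elim: bcast_class.cases)
  let ?h = "\<lambda>s. real (step_degree 1 p s)"
  define H where "H = (\<Sum>s\<leftarrow>steps B. if counted p s then ?h s else 0)"
  define T where "T = (\<Sum>s\<leftarrow>steps B. if counted p s then 1 else 0 :: real)"
  \<comment> \<open>Used with \<open>u = 1\<close>, \<open>w = \<sigma>\<close> for the cost and
    with \<open>u = 1 / \<theta>\<close>, \<open>w = ln \<theta>\<close> for the growth
    exponent.\<close>
  have lin: "(\<Sum>s\<leftarrow>ss. if counted p s then u * ?h s + w else 0) =
      u * (\<Sum>s\<leftarrow>ss. if counted p s then ?h s else 0) + (\<Sum>s\<leftarrow>ss. if counted p s then 1 else 0) * w"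
    for ss :: "'w step list" and u w
    by (induction ss) (auto simp: algebra_simps)
  show ?thesis
  proof (rule that)
    show "0 \<le> H" unfolding H_def by (rule sum_list_nonneg) auto
    show "0 \<le> T" unfolding T_def by (rule sum_list_nonneg) auto
    show "comm B p \<sigma> = H + T * \<sigma>" for \<sigma>
      using lin[of 1 \<sigma> "steps B"] assms(2,3) by (simp add: comm_eq_sum_list H_def T_def cong: if_cong)
    fix \<theta> :: real assume \<theta>: "1 \<le> \<theta>"
    let ?g = "\<lambda>s. if counted p s then 1 / \<theta> * ?h s + ln \<theta> else 0"
    let ?R = "{fst (loc B 0)}"
    have "real (1 + step_degree 1 p s) \<le> exp (?g s)" if "s \<in> set (steps B)" for s
    proof (cases "counted p s")
      case True
      have "1 + ?h s \<le> \<theta> * (1 + ?h s / \<theta>)" using \<theta> by (simp add: field_simps)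
      \<comment> \<open>This is \<open>1 + x \<le> exp x\<close> at
        \<open>x = h / \<theta>\<close>.\<close>
      also have "\<dots> \<le> \<theta> * exp (?h s / \<theta>)" using \<theta> by (intro mult_left_mono) auto
      also have "\<dots> = exp (?g s)" using \<theta> True by (simp add: exp_add)
      finally show ?thesis by simp
    next
      case False
      \<comment> \<open>Every label of a valid step is below \<open>levels p\<close>, so an
        uncounted step has no label and carries no messages.\<close>
      have "valid_step \<mu> p s" using B that assms(2) by (auto simp: broadcast_algo_def)
      with False have "msgs s = {}"
        by (auto simp: valid_step_def counted_def split: option.splits)
      then have "step_degree 1 p s = 0"
        using \<open>0 < p\<close> by (simp add: step_degree_def image_constant_conv lessThan_empty_iff)
      with False show ?thesis by simp
    qed
    moreover have "\<forall>s\<in>set (steps B). valid_step \<mu> p s"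
      using B assms(2) by (auto simp: broadcast_algo_def)
    ultimately have fin: "finite (fold spread (steps B) ?R)"
      and le: "real (card (fold spread (steps B) ?R)) \<le> real (card ?R) * exp (\<Sum>s\<leftarrow>steps B. ?g s)"
      using card_fold_spread_le[of "steps B" \<mu> p ?g ?R] by auto
    have "\<epsilon> * real p \<le> real (card (fold spread (steps B) ?R))"
      using B(2) card_mono[OF fin broadcast_spread[OF B(1) assms(5,4)]] by linarith
    with le show "\<epsilon> * real p \<le> exp (T * ln \<theta> + H / \<theta>)"
      using lin[of "1 / \<theta>" "ln \<theta>" "steps B"] by (simp add: H_def T_def add.commute)
  qed
qed


section \<open>Broadcasting along a tree\<close>

text \<open>The multiples of \<open>2 ^ a\<close> send to the multiples of \<open>2 ^ b\<close>; a message is identified by its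
  destination.\<close>

definition tree_step :: "nat \<Rightarrow> nat \<Rightarrow> nat \<Rightarrow> 'w step" where
  "tree_step k a b =
     \<lparr>label = Some (k - a),
      msgs = {j. j < 2 ^ k \<and> 2 ^ b dvd j \<and> \<not> 2 ^ a dvd j},
      src = (\<lambda>j. j div 2 ^ a * 2 ^ a),
      dst = (\<lambda>j. j),
      payload = (\<lambda>j m. [m 0]),
      update = (\<lambda>j m inbox. if inbox j = [] then m else (\<lambda>_. hd (inbox j)))\<rparr>"

text \<open>Makes the memory of element 0 constantly \<open>V[0]\<close>. Tree steps pass on such
  constant memories, so that in the end every cell holds the value, wherever the entries are
  located.\<close>

definition copy_step :: "'w step" where
  "copy_step = \<lparr>label = None, msgs = {}, src = (\<lambda>j. j), dst = (\<lambda>j. j), payload = (\<lambda>j m. []),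
     update = (\<lambda>j m inbox. \<lambda>_. m 0)\<rparr>"

text \<open>Round \<open>t\<close> refines the set of informed elements from the multiples of
  \<open>2 ^ (k - t * d)\<close> to those of \<open>2 ^ (k - Suc t * d)\<close>, a tree of arity
  about \<open>2 ^ d\<close>. Truncated subtraction shortens the last round if \<open>d\<close> does
  not divide \<open>k\<close>. Entries are dealt out cyclically.\<close>

definition tree_algo :: "nat \<Rightarrow> nat \<Rightarrow> 'w algo" where
  "tree_algo k d =
     \<lparr>npes = 2 ^ k,
      loc = (\<lambda>i. (i mod 2 ^ k, i div 2 ^ k)),
      blank = (\<lambda>_ _. undefined),
      steps = copy_step #
        map (\<lambda>t. tree_step k (k - t * d) (k - Suc t * d)) [0..<(k + d - 1) div d]\<rparr>"

lemma npes_tree_algo [simp]: "npes (tree_algo k d) = 2 ^ k"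
  by (simp add: tree_algo_def)

text \<open>Messages stay inside aligned blocks of \<open>2 ^ a\<close> elements, so both ends agree
  in the top \<open>k - a\<close> bits; \<open>0 < a\<close> makes this label legal.\<close>

lemma valid_tree_step:
  assumes "0 < a" and "a \<le> k" and "1 \<le> \<mu>"
  shows "valid_step \<mu> (2 ^ k) (tree_step k a b)"
proof -
  have "j div 2 ^ a * 2 ^ a < 2 ^ k" if "j < 2 ^ k" for j :: nat
    using that div_times_less_eq_dividend[of j "2 ^ a"] by linarith
  moreover have "1 \<le> k" using assms by simp
  ultimately show ?thesis
    using assms by (auto simp: valid_step_def tree_step_def levels_pow2 pow2_div)
qed

lemma run_step_tree_step:
  assumes "\<And>j. j < 2 ^ k \<Longrightarrow> 2 ^ a dvd j \<Longrightarrow> M j = (\<lambda>_. x)"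
    and "j < 2 ^ k" and "2 ^ b dvd j"
  shows "run_step (tree_step k a b) M j = (\<lambda>_. x)"
proof (cases "2 ^ a dvd j")
  case True
  then show ?thesis using assms by (simp add: run_step_def tree_step_def)
next
  case False
  have "j div 2 ^ a * 2 ^ a < 2 ^ k"
    using \<open>j < 2 ^ k\<close> div_times_less_eq_dividend[of j "2 ^ a"] by linarith
  then have "M (j div 2 ^ a * 2 ^ a) = (\<lambda>_. x)" by (intro assms(1)) auto
  with False assms show ?thesis by (simp add: run_step_def tree_step_def)
qed

lemma run_tree_steps:
  assumes "M 0 = (\<lambda>_. x)" and "j < 2 ^ k" and "2 ^ (k - r * d) dvd j"
  shows "fold run_step (map (\<lambda>t. tree_step k (k - t * d) (k - Suc t * d)) [0..<r]) M j = (\<lambda>_. x)"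
  using assms(2,3)
proof (induction r arbitrary: j)
  case 0
  \<comment> \<open>Before the first round, 0 is the only multiple of \<open>2 ^ k\<close> in
    range.\<close>
  then have "j = 0" by (auto dest: dvd_imp_le)
  with assms(1) show ?case by simp
next
  case (Suc r)
  show ?case
    using run_step_tree_step[OF Suc.IH Suc.prems] by simp
qed

lemma broadcast_tree_algo:
  assumes "1 \<le> k" and "1 \<le> d" and "1 \<le> \<mu>" and "1 \<le> n"
  shows "broadcast_algo \<mu> n (tree_algo k d :: 'w algo)"
proof -
  define r where "r = (k + d - 1) div d"
  have r_iff: "t < r \<longleftrightarrow> t * d < k" for t
    unfolding r_def using assms by (intro less_ceiling_div_iff) simp
  \<comment> \<open>Since \<open>r\<close> is not below itself, \<open>r * d \<ge> k\<close>; hence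
    after \<open>r\<close> rounds all multiples of \<open>2 ^ 0\<close>, that is all elements, are
    informed.\<close>
  have r: "k - r * d = 0" using r_iff[of r] by simp
  have inj: "inj_on (loc (tree_algo k d :: 'w algo)) {..<n}"
    by (rule inj_onI) (simp add: tree_algo_def, metis div_mod_decomp)
  have "run (tree_algo k d) (load (tree_algo k d) n V) j = (\<lambda>_. V 0)" if "j < 2 ^ k"
    for j and V :: "nat \<Rightarrow> 'w"
  proof -
    have 0: "loc (tree_algo k d :: 'w algo) 0 = (0, 0)" by (simp add: tree_algo_def)
    have "(THE i. i < n \<and> loc (tree_algo k d :: 'w algo) i = (0, 0)) = 0"
      using 0 assms inj by (intro the_equality) (auto simp: inj_on_def)
    then have "load (tree_algo k d) n V 0 0 = V 0"
      using 0 assms by (auto simp: load_def)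
    then have "run_step copy_step (load (tree_algo k d) n V) 0 = (\<lambda>_. V 0)"
      by (simp add: run_step_def copy_step_def)
    from run_tree_steps[of "run_step copy_step (load (tree_algo k d) n V)" "V 0", OF this that, of r d] r
    show ?thesis
      by (simp add: run_def tree_algo_def r_def)
  qed
  moreover have "valid_step \<mu> (2 ^ k) s" if "s \<in> set (steps (tree_algo k d))" for s :: "'w step"
  proof -
    have "valid_step \<mu> (2 ^ k) (copy_step :: 'w step)"
      by (simp add: valid_step_def copy_step_def)
    moreover have "valid_step \<mu> (2 ^ k) (tree_step k (k - t * d) (k - Suc t * d) :: 'w step)"
      if "t < r" for t
      using that r_iff[of t] assms by (intro valid_tree_step) auto
    moreover have "s = copy_step \<or> (\<exists>t<r. s = tree_step k (k - t * d) (k - Suc t * d))"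
      using that by (auto simp: tree_algo_def r_def)
    ultimately show ?thesis by blast
  qed
  moreover have "fst (loc (tree_algo k d :: 'w algo) i) < 2 ^ k" for i
    by (simp add: tree_algo_def)
  ultimately show ?thesis
    using inj by (simp add: broadcast_algo_def pow2_def)
qed

text \<open>The receivers from \<open>j\<close> are among \<open>j + x * 2 ^ b\<close> with
  \<open>x < 2 ^ (a - b)\<close>, and no element receives more than one message.\<close>

lemma step_degree_tree_step_le:
  assumes "b \<le> a"
  shows "step_degree 1 (2 ^ k) (tree_step k a b) \<le> 2 ^ (a - b)"
proof -
  let ?s = "tree_step k a b"
  have out: "card {l \<in> msgs ?s. src ?s l = j \<and> dst ?s l \<noteq> j} \<le> 2 ^ (a - b)" for j
  proof -
    have "{l \<in> msgs ?s. src ?s l = j \<and> dst ?s l \<noteq> j} \<subseteq> (\<lambda>x. j + x * 2 ^ b) ` {..<2 ^ (a - b)}"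
    proof
      fix l assume "l \<in> {l \<in> msgs ?s. src ?s l = j \<and> dst ?s l \<noteq> j}"
      then have l: "2 ^ b dvd l" "l div 2 ^ a * 2 ^ a = j" by (auto simp: tree_step_def)
      have "2 ^ b dvd l mod 2 ^ a"
        using l(1) \<open>b \<le> a\<close> by (simp add: dvd_mod le_imp_power_dvd)
      moreover have "l mod 2 ^ a div 2 ^ b < 2 ^ (a - b)"
        using \<open>b \<le> a\<close> by (intro less_mult_imp_div_less) (simp flip: power_add)
      moreover have "l = j + l mod 2 ^ a"
        using l(2) by (metis div_mult_mod_eq)
      ultimately show "l \<in> (\<lambda>x. j + x * 2 ^ b) ` {..<2 ^ (a - b)}"
        by (intro image_eqI[of _ _ "l mod 2 ^ a div 2 ^ b"]) auto
    qed
    then have "card {l \<in> msgs ?s. src ?s l = j \<and> dst ?s l \<noteq> j}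
        \<le> card ((\<lambda>x. j + x * 2 ^ b) ` {..<2 ^ (a - b)})"
      by (intro card_mono) auto
    also have "\<dots> \<le> 2 ^ (a - b)"
      using card_image_le[of "{..<2 ^ (a - b)}" "\<lambda>x. j + x * 2 ^ b"] by simp
    finally show ?thesis .
  qed
  have "card {l \<in> msgs ?s. dst ?s l = j \<and> src ?s l \<noteq> j} \<le> 2 ^ (a - b)" for j
  proof -
    have "card {l \<in> msgs ?s. dst ?s l = j \<and> src ?s l \<noteq> j} \<le> card {j}"
      by (intro card_mono) (auto simp: tree_step_def)
    also have "\<dots> \<le> 2 ^ (a - b)" by simp
    finally show ?thesis .
  qed
  with out show ?thesis
    unfolding step_degree_def div_by_1 by (intro Max.boundedI) (auto simp: lessThan_empty_iff)
qed

lemma comm_tree_algo_le: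
  assumes "1 \<le> d" and "0 \<le> \<sigma>"
  shows "comm (tree_algo k d) (2 ^ k) \<sigma> \<le> real ((k + d - 1) div d) * (2 ^ d + \<sigma>)"
proof -
  define r where "r = (k + d - 1) div d"
  define f :: "'a step \<Rightarrow> real"
    where "f s = (if counted (2 ^ k) s then real (step_degree 1 (2 ^ k) s) + \<sigma> else 0)" for s
  have f: "f (tree_step k (k - t * d) (k - Suc t * d)) \<le> 2 ^ d + \<sigma>" for t
  proof -
    have "step_degree 1 (2 ^ k) (tree_step k (k - t * d) (k - Suc t * d) :: 'a step)
        \<le> 2 ^ (k - t * d - (k - Suc t * d))"
      by (intro step_degree_tree_step_le) auto
    also have "\<dots> \<le> 2 ^ d" by (intro power_increasing) auto
    finally show ?thesis
      using assms(2) by (auto simp: f_def)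
  qed
  have "comm (tree_algo k d :: 'a algo) (2 ^ k) \<sigma> = (\<Sum>s\<leftarrow>steps (tree_algo k d). f s)"
    by (simp add: comm_eq_sum_list f_def[abs_def] cong: if_cong)
  also have "\<dots> = (\<Sum>t\<leftarrow>[0..<r]. f (tree_step k (k - t * d) (k - Suc t * d)))"
    by (simp add: tree_algo_def o_def r_def f_def counted_def copy_step_def)
  also have "\<dots> \<le> (\<Sum>t\<leftarrow>[0..<r]. 2 ^ d + \<sigma>)"
    by (intro sum_list_mono f)
  also have "\<dots> = real r * (2 ^ d + \<sigma>)" by (simp add: sum_list_triv)
  finally show ?thesis by (simp add: r_def)
qed

lemma tree_algo_in_bcast_class:
  assumes "\<epsilon> \<le> 1" and "1 \<le> \<mu>" and "1 \<le> n" and "1 \<le> k" and "1 \<le> d" and "\<epsilon> * 2 ^ k \<le> real n"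
  shows "tree_algo k d \<in> bcast_class \<epsilon> \<mu> n"
proof (rule bcast_classI[where m = "min n (2 ^ k)"])
  show "(\<lambda>i. fst (loc (tree_algo k d) i)) ` {..<n} = {..<min n (2 ^ k)}"
  proof (intro set_eqI iffI)
    fix x assume "x \<in> (\<lambda>i. fst (loc (tree_algo k d) i)) ` {..<n}"
    then show "x \<in> {..<min n (2 ^ k)}"
      by (auto simp: tree_algo_def intro: le_less_trans[OF mod_less_eq_dividend])
  next
    fix x assume "x \<in> {..<min n (2 ^ k)}"
    then show "x \<in> (\<lambda>i. fst (loc (tree_algo k d) i)) ` {..<n}"
      by (auto simp: tree_algo_def intro!: image_eqI[of _ _ x])
  qed
  show "\<epsilon> * real (npes (tree_algo k d)) \<le> real (min n (2 ^ k))"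
    using assms by (auto simp: tree_algo_def min_def)
qed (use assms in \<open>simp add: broadcast_tree_algo\<close>)

section \<open>Upper bound on the optimum\<close>

text \<open>With \<open>d\<close> the rounded-down logarithm of \<open>s = max 2 \<sigma>\<close>,
  the degree of a round is at most \<open>s\<close>, so a round costs at most
  \<open>2 * s\<close>.\<close>

lemma best_comm_le:
  assumes "\<epsilon> \<le> 1" and "1 \<le> \<mu>" and "1 \<le> n" and "1 \<le> k" and "\<epsilon> * 2 ^ k \<le> real n"
    and "0 \<le> \<sigma>" and K: "log 2 (max 2 \<sigma>) \<le> K * real k"
  shows "best_comm (bcast_class \<epsilon> \<mu> n :: 'w algo set) (2 ^ k) \<sigma>
    \<le> ereal (2 * (2 + K) * (max 2 \<sigma> * real k / log 2 (max 2 \<sigma>)))"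
proof -
  define s where "s = max 2 \<sigma>"
  define L where "L = log 2 s"
  define d where "d = nat \<lfloor>L\<rfloor>"
  define r where "r = (k + d - 1) div d"
  have s: "2 \<le> s" "\<sigma> \<le> s" by (auto simp: s_def)
  have L: "1 \<le> L" using s by (simp add: L_def)
  have d: "1 \<le> d" "real d \<le> L" "L < real d + 1"
    using L unfolding d_def by (auto simp: le_nat_iff le_floor_iff)
  have "2 ^ d \<le> s"
    using d(2) s by (simp add: L_def le_log_iff powr_realpow)
  have "real r \<le> real k / real d + 1"
  proof -
    have "r * d \<le> k + d - 1" by (simp add: r_def)
    then have "real r * real d \<le> real k + real d"
      by (metis (mono_tags) diff_le_self le_trans of_nat_add of_nat_le_iff of_nat_mult)
    with d show ?thesis by (simp add: field_simps)
  qed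
  also have "real k / real d \<le> 2 * real k / L"
  proof -
    \<comment> \<open>Rounding down loses at most a factor 2 because
      \<open>d \<ge> 1\<close>.\<close>
    have "L \<le> 2 * real d" using d by linarith
    then have "real k * L \<le> real k * (2 * real d)" by (intro mult_left_mono) auto
    with d L show ?thesis by (simp add: field_simps)
  qed
  \<comment> \<open>The bound on \<open>\<sigma>\<close> absorbs the extra round that comes from
    rounding up; this is where \<open>K\<close> enters the constant.\<close>
  also have "1 \<le> K * real k / L"
    using K L by (simp add: L_def s_def)
  finally have r: "real r \<le> (2 + K) * real k / L"
    by (simp add: algebra_simps add_divide_distrib)
  let ?B = "tree_algo k d :: 'w algo"
  have "best_comm (bcast_class \<epsilon> \<mu> n :: 'w algo set) (2 ^ k) \<sigma> \<le> ereal (comm ?B (2 ^ k) \<sigma>)"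
    unfolding best_comm_def
    by (rule INF_lower) (use tree_algo_in_bcast_class[of \<epsilon> \<mu> n k d] assms d in
        simp)
  also have "comm ?B (2 ^ k) \<sigma> \<le> real r * (2 ^ d + \<sigma>)"
    unfolding r_def by (rule comm_tree_algo_le) (use d assms in auto)
  also have "\<dots> \<le> (2 + K) * real k / L * (2 * s)"
    using r \<open>2 ^ d \<le> s\<close> s \<open>0 \<le> \<sigma>\<close> by (intro mult_mono) auto
  also have "\<dots> = 2 * (2 + K) * (s * real k / L)" by simp
  finally show ?thesis by (simp add: L_def s_def)
qed


section \<open>The gap\<close>

lemma best_comm_nonneg: "0 \<le> \<sigma> \<Longrightarrow> 0 \<le> best_comm C p \<sigma>"
  unfolding best_comm_def by (rule INF_greatest) (simp add: comm_nonneg)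

lemma comm_ratio_ge:
  assumes "0 \<le> \<sigma>" and "0 < Y" and "Y \<le> comm A p \<sigma>" and "0 < X" and "best_comm C p \<sigma> \<le> ereal X"
  shows "ereal (Y / X) \<le> comm_ratio C A p \<sigma>"
proof (cases "best_comm C p \<sigma>")
  case (real z)
  have z: "0 \<le> z" "z \<le> X" using best_comm_nonneg[OF assms(1), of C p] assms(5) real by auto
  have c: "0 < comm A p \<sigma>" using assms by linarith
  show ?thesis
  proof (cases "z = 0")
    case True
    \<comment> \<open>The cost is positive, so the ratio is \<open>\<infinity>\<close> and the
      convention for \<open>0 / 0\<close> does not apply.\<close>
    with c real show ?thesis by (simp add: comm_ratio_def divide_ereal_def zero_ereal_def[symmetric])
  next
    case False
    with z assms have "Y / X \<le> comm A p \<sigma> / z" by (intro frac_le) auto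
    with c real False show ?thesis by (simp add: comm_ratio_def)
  qed
qed (use best_comm_nonneg[OF assms(1), of C p] assms(5) in auto)

lemma comm_ratio_ge_1:
  assumes "0 \<le> \<sigma>" and "best_comm C p \<sigma> \<le> ereal (comm A p \<sigma>)"
  shows "1 \<le> comm_ratio C A p \<sigma>"
proof (cases "comm A p \<sigma> = 0")
  case True
  with assms best_comm_nonneg[OF assms(1), of C p] show ?thesis
    by (simp add: comm_ratio_def zero_ereal_def[symmetric] antisym)
next
  case False
  with comm_nonneg[OF assms(1), of A p] have "0 < comm A p \<sigma>" by simp
  from comm_ratio_ge[OF assms(1) this order_refl this assms(2)] this show ?thesis
    by (simp add: one_ereal_def)
qed

text \<open>With threshold \<open>\<theta> = s1 * log s2\<close>, where \<open>si = max 2 \<sigma>i\<close>, either there are at least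
  \<open>k / (4 * log \<theta>)\<close> supersteps, which is expensive at \<open>\<sigma>2\<close>, or the degrees add up to at least
  \<open>\<theta> * k / 8\<close>, which is expensive at \<open>\<sigma>1\<close>.\<close>

lemma gap_ge:
  fixes A :: "'w algo"
  assumes "0 < \<epsilon>" and "\<epsilon> \<le> 1" and "1 \<le> \<mu>" and "\<exists>x y :: 'w. x \<noteq> y"
    and "A \<in> bcast_class \<epsilon> \<mu> n" and "1 \<le> n" and "1 \<le> k" and "2 ^ k \<le> npes A"
    and "0 \<le> \<sigma>1" and "\<sigma>1 \<le> \<sigma>2" and "2 < \<sigma>2" and "1 \<le> K" and "log 2 \<sigma>2 \<le> K * real k"
    and "2 * log 2 (1 / \<epsilon>) \<le> real k"
  shows "ereal (log 2 \<sigma>2 / (log 2 (max 2 \<sigma>1) + lg (log 2 \<sigma>2)) / (16 * (2 + K)))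
    \<le> gap (bcast_class \<epsilon> \<mu> n) A (2 ^ k) \<sigma>1 \<sigma>2"
proof -
  define s1 where "s1 = max 2 \<sigma>1"
  define L1 where "L1 = log 2 s1"
  define L2 where "L2 = log 2 \<sigma>2"
  define l where "l = lg L2"
  define \<theta> where "\<theta> = s1 * L2"
  define C where "C = 2 * (2 + K)"
  let ?C = "bcast_class \<epsilon> \<mu> n :: 'w algo set"
  have s1: "2 \<le> s1" "\<sigma>1 \<le> s1" "s1 \<le> \<sigma>2" using assms by (auto simp: s1_def)
  have L: "1 \<le> L1" "L1 \<le> L2" using s1 by (auto simp: L1_def L2_def)
  have l: "1 \<le> l" "log 2 L2 \<le> l" by (auto simp: l_def lg_def)
  have "0 < C" "0 < real k" using assms by (auto simp: C_def)
  have "2 * 1 \<le> \<theta>" unfolding \<theta>_def using s1 L by (intro mult_mono) auto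
  then have \<theta>: "2 \<le> \<theta>" by simp
  have log\<theta>: "1 \<le> log 2 \<theta>" "log 2 \<theta> \<le> L1 + l"
    using \<theta> by simp (use s1 L l in \<open>simp add: \<theta>_def L1_def log_mult\<close>)
  obtain B where B: "B \<in> ?C" "npes B = 2 ^ k" "\<And>\<sigma>. comm B (2 ^ k) \<sigma> = comm A (2 ^ k) \<sigma>"
  proof (rule bcast_class_fold[OF assms(5) _ _ assms(8)])
    show "pow2 (2 ^ k)" by (auto simp: pow2_def)
    show "1 < (2 :: nat) ^ k" using \<open>1 \<le> k\<close> by (intro one_less_power) auto
  qed blast
  obtain H T where HT: "0 \<le> H" "0 \<le> T" "\<And>\<sigma>. comm A (2 ^ k) \<sigma> = H + T * \<sigma>"
    and low: "\<And>\<theta>. 1 \<le> \<theta> \<Longrightarrow> \<epsilon> * real (2 ^ k) \<le> exp (T * ln \<theta> + H / \<theta>)"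
    using bcast_class_lower[OF B(1,2) _ assms(6,4)] B(3) by auto
  have "\<epsilon> * real (npes B) \<le> real (card ((\<lambda>i. fst (loc B i)) ` {..<n}))"
    using B(1) by (auto elim: bcast_class.cases)
  also have "\<dots> \<le> real n"
    using card_image_le[of "{..<n}" "\<lambda>i. fst (loc B i)"] by simp
  \<comment> \<open>The existence of some member of the class forces enough entries for the tree to
    belong to it as well.\<close>
  finally have n: "\<epsilon> * 2 ^ k \<le> real n" by (simp add: B(2))
  have best: "best_comm ?C (2 ^ k) \<sigma> \<le> ereal (C * (max 2 \<sigma> * real k / log 2 (max 2 \<sigma>)))"
    if "0 \<le> \<sigma>" "\<sigma> \<le> \<sigma>2" for \<sigma>
  proof -
    have "log 2 (max 2 \<sigma>) \<le> log 2 \<sigma>2" using that assms by simp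
    then have "log 2 (max 2 \<sigma>) \<le> K * real k" using assms by linarith
    from best_comm_le[OF assms(2,3,6,7) n that(1) this] show ?thesis by (simp add: C_def)
  qed
  have gap: "comm_ratio ?C A (2 ^ k) \<sigma> \<le> gap ?C A (2 ^ k) \<sigma>1 \<sigma>2" if "\<sigma> \<in> {\<sigma>1..\<sigma>2}" for \<sigma>
    unfolding gap_def using that by (rule SUP_upper)
  define G where "G = L2 / (L1 + l) / (8 * C)"
  have "ln (\<epsilon> * 2 ^ k) \<le> T * ln \<theta> + H / \<theta>"
  proof -
    have "ln (\<epsilon> * 2 ^ k) \<le> ln (exp (T * ln \<theta> + H / \<theta>))"
      using low[of \<theta>] \<theta> assms(1) by (subst ln_le_cancel_iff) auto
    then show ?thesis by simp
  qed
  then have "ln \<epsilon> + real k * ln 2 \<le> T * ln \<theta> + H / \<theta>"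
    using assms(1) by (simp add: ln_mult ln_realpow)
  \<comment> \<open>The assumption on \<open>k\<close> lets the loss from \<open>\<epsilon>\<close>
    consume at most half of \<open>k * ln 2\<close>.\<close>
  moreover have "2 * (- ln \<epsilon>) \<le> real k * ln 2"
  proof -
    have "2 * log 2 (1 / \<epsilon>) * ln 2 = 2 * (- ln \<epsilon>)"
      using assms(1) by (simp add: log_def ln_div)
    with mult_right_mono[OF assms(14), of "ln 2"] show ?thesis by simp
  qed
  ultimately have "real k * ln 2 / 2 \<le> T * ln \<theta> + H / \<theta>" by linarith
  moreover have "H / \<theta> \<le> 2 * H / \<theta> * ln 2"
  proof -
    \<comment> \<open>The factor \<open>2 * ln 2\<close> is inserted so that \<open>ln 2\<close>
      cancels and logarithms to base 2 remain.\<close>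
    have "1 \<le> 2 * ln (2 :: real)" using ln_le_minus_one[of "1 / 2"] by (simp add: ln_div)
    then have "H / \<theta> * 1 \<le> H / \<theta> * (2 * ln 2)"
      using HT(1) \<theta> by (intro mult_left_mono) auto
    then show ?thesis by (simp add: mult_ac)
  qed
  ultimately have "real k * ln 2 / 2 \<le> T * ln \<theta> + 2 * H / \<theta> * ln 2" by linarith
  also have "ln \<theta> = log 2 \<theta> * ln 2" by (simp add: log_def)
  finally have "(real k / 2) * ln 2 \<le> (T * log 2 \<theta> + 2 * H / \<theta>) * ln 2"
    by (simp add: distrib_right mult.assoc)
  then have "real k / 2 \<le> T * log 2 \<theta> + 2 * H / \<theta>" by simp
  then consider "real k / 4 \<le> T * log 2 \<theta>" | "real k / 4 \<le> 2 * H / \<theta>" by linarith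
  then have "ereal G \<le> gap ?C A (2 ^ k) \<sigma>1 \<sigma>2"
  proof cases
    case 1
    \<comment> \<open>\<open>Y\<close> bounds the cost at \<open>\<sigma>2\<close> from below and
      \<open>X\<close> the optimum from above; \<open>\<sigma>2 * k\<close> cancels in the
      quotient.\<close>
    define Y where "Y = real k / (4 * log 2 \<theta>) * \<sigma>2"
    define X where "X = C * (\<sigma>2 * real k / L2)"
    have "real k / (4 * log 2 \<theta>) \<le> T" using 1 log\<theta> by (simp add: field_simps)
    then have "Y \<le> T * \<sigma>2" unfolding Y_def using assms by (intro mult_right_mono) auto
    then have Y: "Y \<le> comm A (2 ^ k) \<sigma>2" using HT by simp
    have pos: "0 < Y" "0 < X"
      unfolding X_def Y_def using log\<theta> L \<open>0 < C\<close> \<open>0 < real k\<close> assms(11) by auto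
    have "G \<le> L2 / log 2 \<theta> / (8 * C)"
      unfolding G_def using log\<theta> L \<open>0 < C\<close> by (intro divide_right_mono divide_left_mono) auto
    also have "\<dots> \<le> L2 / log 2 \<theta> / (4 * C)"
      using log\<theta> L \<open>0 < C\<close> by (intro divide_left_mono) auto
    also have "\<dots> = Y / X"
      unfolding X_def Y_def using log\<theta> L \<open>0 < C\<close> \<open>0 < real k\<close> assms(11) by (simp add: field_simps)
    finally have "ereal G \<le> ereal (Y / X)" by simp
    also have "\<dots> \<le> comm_ratio ?C A (2 ^ k) \<sigma>2"
      using best[of \<sigma>2] assms by (intro comm_ratio_ge pos Y) (auto simp: X_def L2_def max_def)
    also have "\<dots> \<le> gap ?C A (2 ^ k) \<sigma>1 \<sigma>2" using assms by (intro gap) auto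
    finally show ?thesis .
  next
    case 2
    \<comment> \<open>Now the bounds are taken at \<open>\<sigma>1\<close>: the factor
      \<open>s1\<close> of \<open>\<theta>\<close> cancels against the tree cost, and its factor
      \<open>L2\<close> alone exceeds the required ratio.\<close>
    define Y where "Y = \<theta> * real k / 8"
    define X where "X = C * (s1 * real k / L1)"
    have "Y \<le> H" using 2 \<theta> by (simp add: Y_def field_simps)
    moreover have "0 \<le> T * \<sigma>1" using HT(2) assms by simp
    ultimately have Y: "Y \<le> comm A (2 ^ k) \<sigma>1" using HT(3) by simp
    have pos: "0 < Y" "0 < X"
      unfolding X_def Y_def using \<theta> L s1 \<open>0 < C\<close> \<open>0 < real k\<close> by auto
    have "L2 / (L1 + l) \<le> L2 / 1" using L l by (intro divide_left_mono) auto
    also have "\<dots> \<le> L1 * L2" using L by simp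
    finally have "G \<le> L1 * L2 / (8 * C)"
      unfolding G_def using \<open>0 < C\<close> by (intro divide_right_mono) auto
    also have "\<dots> = Y / X"
      unfolding X_def Y_def \<theta>_def using L s1 \<open>0 < C\<close> \<open>0 < real k\<close> by (simp add: field_simps)
    finally have "ereal G \<le> ereal (Y / X)" by simp
    also have "\<dots> \<le> comm_ratio ?C A (2 ^ k) \<sigma>1"
      using best[of \<sigma>1] assms by (intro comm_ratio_ge pos Y) (auto simp: X_def L1_def s1_def)
    also have "\<dots> \<le> gap ?C A (2 ^ k) \<sigma>1 \<sigma>2" using assms by (intro gap) auto
    finally show ?thesis .
  qed
  then show ?thesis by (simp add: G_def C_def L1_def L2_def l_def s1_def)
qed

section \<open>The trivial bound and the choice of the constant\<close>

text \<open>The folding of \<open>A\<close> to \<open>p\<close> elements itself competes for the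
  optimum.\<close>

lemma gap_ge_1:
  fixes A :: "'w algo"
  assumes "A \<in> bcast_class \<epsilon> \<mu> n" and "pow2 p" and "1 < p" and "p \<le> npes A"
    and "0 \<le> \<sigma>1" and "\<sigma>1 \<le> \<sigma>2"
  shows "1 \<le> gap (bcast_class \<epsilon> \<mu> n) A p \<sigma>1 \<sigma>2"
proof -
  obtain B :: "'w algo" where "B \<in> bcast_class \<epsilon> \<mu> n" "npes B = p" "\<And>\<sigma>. comm B p \<sigma> = comm A p \<sigma>"
    by (rule bcast_class_fold[OF assms(1-4)]) blast
  then have "best_comm (bcast_class \<epsilon> \<mu> n :: 'w algo set) p \<sigma>1 \<le> ereal (comm A p \<sigma>1)"
    unfolding best_comm_def by (intro INF_lower2[of B]) auto
  then have "1 \<le> comm_ratio (bcast_class \<epsilon> \<mu> n) A p \<sigma>1"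
    by (rule comm_ratio_ge_1[OF assms(5)])
  also have "\<dots> \<le> gap (bcast_class \<epsilon> \<mu> n) A p \<sigma>1 \<sigma>2"
    unfolding gap_def using assms by (intro SUP_upper) auto
  finally show ?thesis .
qed

theorem theorem8:
  fixes \<epsilon> :: real and \<mu> :: nat
  assumes "0 < \<epsilon>" and "\<epsilon> \<le> 1" and "1 \<le> \<mu>"
    and "\<exists>x y :: 'w. x \<noteq> y"
  shows "\<exists>c :: real \<Rightarrow> real. (\<forall>K. 0 < c K) \<and>
           (\<forall>(v :: nat \<Rightarrow> nat) (A :: nat \<Rightarrow> 'w algo). network_oblivious_bcast \<epsilon> \<mu> v A \<longrightarrow>
             (\<forall>n\<ge>1. \<forall>p \<sigma>1 \<sigma>2. pow2 p \<and> 1 < p \<and> p \<le> v n \<and> 0 \<le> \<sigma>1 \<and> \<sigma>1 \<le> \<sigma>2 \<longrightarrow>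
               (\<forall>K. \<sigma>2 \<le> real p powr K \<longrightarrow>
                 gap (bcast_class \<epsilon> \<mu> n) (A n) p \<sigma>1 \<sigma>2 \<ge>
                   ereal (c K * (lg (max 2 \<sigma>2) / (lg (max 2 \<sigma>1) + lg (lg (max 2 \<sigma>2))))))))"
proof -
  define K' :: "real \<Rightarrow> real" where "K' K = 1 + max 0 K" for K
  define e where "e = log 2 (1 / \<epsilon>)"
  \<comment> \<open>The first summand of the denominator serves large \<open>p\<close>; the second
    makes the claimed bound at most 1 when \<open>p\<close> is too small compared with
    \<open>1 / \<epsilon>\<close>.\<close>
  define c where "c K = 1 / (16 * (2 + K' K) + 2 * e * K' K)" for K
  have e: "0 \<le> e" using assms by (simp add: e_def)
  have K': "1 \<le> K' K" "K \<le> K' K" for K by (auto simp: K'_def)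
  have den: "1 \<le> 16 * (2 + K' K)" "0 \<le> 2 * e * K' K" for K
    using K'(1)[of K] e by auto
  have c: "0 < c K" "c K \<le> 1" "c K \<le> 1 / (16 * (2 + K' K))" "c K * (2 * e * K' K) \<le> 1" for K
    unfolding c_def using den[of K] by (auto simp: divide_le_eq intro!: frac_le add_pos_nonneg)
  show ?thesis
  proof (intro exI[of _ c] conjI allI impI)
    show "0 < c K" for K by (rule c)
    fix v :: "nat \<Rightarrow> nat" and A :: "nat \<Rightarrow> 'w algo" and n p :: nat and \<sigma>1 \<sigma>2 K :: real
    assume A: "network_oblivious_bcast \<epsilon> \<mu> v A" and n: "1 \<le> n"
      and p: "pow2 p \<and> 1 < p \<and> p \<le> v n \<and> 0 \<le> \<sigma>1 \<and> \<sigma>1 \<le> \<sigma>2"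
      and \<sigma>2: "\<sigma>2 \<le> real p powr K"
    define D where "D = lg (max 2 \<sigma>1) + lg (lg (max 2 \<sigma>2))"
    have lg: "1 \<le> lg x" for x by (simp add: lg_def)
    then have D: "1 \<le> D" and L2: "1 \<le> lg (max 2 \<sigma>2)"
      using add_mono[OF lg lg, of "max 2 \<sigma>1" "lg (max 2 \<sigma>2)"] by (simp_all add: D_def)
    have An: "A n \<in> bcast_class \<epsilon> \<mu> n" "npes (A n) = v n"
      using A n by (auto simp: network_oblivious_bcast_def)
    let ?gap = "gap (bcast_class \<epsilon> \<mu> n) (A n) p \<sigma>1 \<sigma>2"
    have gap1: "1 \<le> ?gap" using gap_ge_1[OF An(1)] An(2) p by auto
    obtain k where k: "p = 2 ^ k" using p by (auto simp: pow2_def)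
    have k1: "1 \<le> k" using p k by (cases k) auto
    \<comment> \<open>As \<open>D \<ge> 1\<close>, the claim then follows from the trivial
      bound.\<close>
    have small: "ereal (c K * (lg (max 2 \<sigma>2) / D)) \<le> ?gap" if "c K * lg (max 2 \<sigma>2) \<le> 1"
    proof -
      have "c K * lg (max 2 \<sigma>2) / D \<le> 1" using that D by simp
      then have "ereal (c K * (lg (max 2 \<sigma>2) / D)) \<le> 1" by (simp add: one_ereal_def)
      with gap1 show ?thesis by (rule order_trans[rotated])
    qed
    have "ereal (c K * (lg (max 2 \<sigma>2) / D)) \<le> ?gap"
    proof (cases "\<sigma>2 \<le> 2")
      case True
      then have "lg (max 2 \<sigma>2) = 1" by (simp add: lg_def)
      then show ?thesis using c(2)[of K] by (intro small) simp
    next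
      case False
      then have lg2: "lg (max 2 \<sigma>2) = log 2 \<sigma>2" "lg (max 2 \<sigma>1) = log 2 (max 2 \<sigma>1)"
        by (simp_all add: lg_def max_def)
      have "log 2 \<sigma>2 \<le> log 2 (real p powr K)"
        using \<sigma>2 False by (intro log_mono) auto
      also have "\<dots> = K * real k" by (simp add: k log_powr log_nat_power)
      also have "\<dots> \<le> K' K * real k" using K' by (intro mult_right_mono) auto
      finally have *: "log 2 \<sigma>2 \<le> K' K * real k" .
      show ?thesis
      proof (cases "2 * e \<le> real k")
        case True
        have "c K * (lg (max 2 \<sigma>2) / D) \<le> 1 / (16 * (2 + K' K)) * (lg (max 2 \<sigma>2) / D)"
          using c(3) D L2 by (intro mult_right_mono) auto
        also have "\<dots> = lg (max 2 \<sigma>2) / D / (16 * (2 + K' K))" by simp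
        finally have "ereal (c K * (lg (max 2 \<sigma>2) / D)) \<le> ereal (lg (max 2 \<sigma>2) / D / (16 * (2 + K' K)))"
          by simp
        also have "\<dots> \<le> ?gap"
          unfolding k D_def lg2
          by (rule gap_ge[OF assms An(1) n k1 _ _ _ _ K'(1) * True[unfolded e_def]])
             (use p k An(2) False in auto)
        finally show ?thesis .
      next
        case small_p: False
        \<comment> \<open>For few elements the bound on \<open>\<sigma>2\<close> keeps
          \<open>log 2 \<sigma>2\<close> below a constant depending on \<open>\<epsilon>\<close> and
          \<open>K\<close> only.\<close>
        have "K' K * real k \<le> K' K * (2 * e)"
          using small_p K'(1)[of K] by (intro mult_left_mono) auto
        with * have "log 2 \<sigma>2 \<le> 2 * e * K' K" by (simp add: mult.commute)
        then have "c K * lg (max 2 \<sigma>2) \<le> c K * (2 * e * K' K)"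
          unfolding lg2 using c(1)[of K] by (intro mult_left_mono) auto
        then show ?thesis using c(4)[of K] by (intro small) linarith
      qed
    qed
    then show "ereal (c K * (lg (max 2 \<sigma>2) / (lg (max 2 \<sigma>1) + lg (lg (max 2 \<sigma>2))))) \<le> ?gap"
      by (simp add: D_def)
  qed
qed

end
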